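(* If $J$ and $K$ are ideals on $\omega$ that are not nearly coherent, then $\mathcal{N}^*_J\not\subseteq\mathcal{N}_K$ and $\mathcal{N}^*_K\not\subseteq\mathcal{N}_J$. In particular, $\mathcal{N}_K\neq\mathcal{N}_J$ and $\mathcal{N}^*_J\neq\mathcal{N}^*_K$.
   Context: An ideal on $\omega$ is a family $J\subseteq\mathcal{P}(\omega)$ closed under subsets and finite unions, containing all finite sets, with $\omega\notin J$; $J^+=\mathcal{P}(\omega)\setminus J$, $J^d=\{\omega\setminus a:a\in J\}$. For $\varphi:\omega\to\omega$, $\varphi^{\to}(J)=\{A:\varphi^{-1}(A)\in J\}$; $J,K$ are nearly coherent iff for some finite-to-one $\varphi:\omega\to\omega$, $\varphi^{\to}(J)\cup\varphi^{\to}(K)$ is contained in some ideal. ${}^\omega2$ has Lebesgue measure $\mu$; $\Omega$ is the set of clopen subsets. For $\bar c\in{}^\omega\Omega$: $N(\bar c)=\{x:x\in c_n\text{ for infinitely many }n\}$, $\overline{\Omega}=\{\bar c:\mu(N(\bar c))=0\}$, $N_J(\bar c)=\{x:\{n:x\in c_n\}\in J^+\}$, $N^*_J(\bar c)=\{x:\{n:x\in c_n\}\in J^d\}$, $\mathcal{N}_J=\{X\subseteq{}^\omega2:\exists\bar c\in\overline{\Omega}\ X\subseteq N_J(\bar c)\}$, $\mathcal{N}^*_J=\{X:\exists\bar c\in\overline{\Omega}\ X\subseteq N^*_J(\bar c)\}$. *)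

theory Defs
  imports "HOL-Probability.Probability"
begin

definition omega_ideal :: "nat set set \<Rightarrow> bool" where
  "omega_ideal J \<longleftrightarrow>
     (\<forall>A\<in>J. \<forall>B. B \<subseteq> A \<longrightarrow> B \<in> J) \<and>
     (\<forall>A\<in>J. \<forall>B\<in>J. A \<union> B \<in> J) \<and>
     (\<forall>A. finite A \<longrightarrow> A \<in> J) \<and>
     UNIV \<notin> J"

definition positive_sets :: "nat set set \<Rightarrow> nat set set" where
  "positive_sets J = - J"

definition dual_filter :: "nat set set \<Rightarrow> nat set set" where
  "dual_filter J = {- a | a. a \<in> J}"

definition push_family :: "(nat \<Rightarrow> nat) \<Rightarrow> nat set set \<Rightarrow> nat set set" where
  "push_family \<phi> J = {A. \<phi> -` A \<in> J}"

definition finite_to_one :: "(nat \<Rightarrow> nat) \<Rightarrow> bool" where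
  "finite_to_one \<phi> \<longleftrightarrow> (\<forall>n. finite (\<phi> -` {n}))"

definition nearly_coherent :: "nat set set \<Rightarrow> nat set set \<Rightarrow> bool" where
  "nearly_coherent J K \<longleftrightarrow>
     (\<exists>\<phi>. finite_to_one \<phi> \<and> (\<exists>I. omega_ideal I \<and> push_family \<phi> J \<union> push_family \<phi> K \<subseteq> I))"

text \<open>The Cantor space is \<^typ>\<open>nat \<Rightarrow> bool\<close> with its type-class topology, i.e. the product of the
  discrete topologies on \<^typ>\<open>bool\<close>. Its Lebesgue measure is the completion of the product of
  the uniform probability measures on \<^typ>\<open>bool\<close>.\<close>

type_synonym cantor = "nat \<Rightarrow> bool"

definition cantor_measure :: "cantor measure" where
  "cantor_measure = completion (Pi\<^sub>M UNIV (\<lambda>_. uniform_count_measure (UNIV :: bool set)))"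

definition clopen_sets :: "cantor set set" where
  "clopen_sets = {c. open c \<and> closed c}"

definition N_limsup :: "(nat \<Rightarrow> cantor set) \<Rightarrow> cantor set" where
  "N_limsup c = {x. \<exists>\<^sub>\<infinity>n. x \<in> c n}"

definition Omega_bar :: "(nat \<Rightarrow> cantor set) set" where
  "Omega_bar = {c. (\<forall>n. c n \<in> clopen_sets) \<and> N_limsup c \<in> null_sets cantor_measure}"

definition N_set :: "nat set set \<Rightarrow> (nat \<Rightarrow> cantor set) \<Rightarrow> cantor set" where
  "N_set J c = {x. {n. x \<in> c n} \<in> positive_sets J}"

definition N_star_set :: "nat set set \<Rightarrow> (nat \<Rightarrow> cantor set) \<Rightarrow> cantor set" where
  "N_star_set J c = {x. {n. x \<in> c n} \<in> dual_filter J}"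

definition N_family :: "nat set set \<Rightarrow> cantor set set" where
  "N_family J = {X. \<exists>c\<in>Omega_bar. X \<subseteq> N_set J c}"

definition N_star_family :: "nat set set \<Rightarrow> cantor set set" where
  "N_star_family J = {X. \<exists>c\<in>Omega_bar. X \<subseteq> N_star_set J c}"

end

theory Submission
  imports Defs
begin

text \<open>
  Let \<open>c n\<close> be the set of sequences vanishing on \<open>[n\<^sup>2, (n+1)\<^sup>2)\<close>; these sets have
  summable measures. Given \<open>d \<in> Omega_bar\<close>, cut \<open>\<omega>\<close> into blocks \<open>[m k, m (k+1))\<close> growing
  so fast that the \<open>d n\<close> with \<open>n < m k\<close> depend only on coordinates below \<open>(m (k+1))\<^sup>2\<close>, while the union of
  the \<open>d n\<close> with \<open>n \<ge> m (k+1)\<close> has measure much smaller than \<open>2\<close> to the power \<open>-(m k)\<^sup>2\<close>.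
  As \<open>J\<close> and \<open>K\<close> are not nearly coherent, the blocks can be coloured so that the
  blocks outside \<open>P\<close> have union in \<open>J\<close>, those outside \<open>Q\<close> have union in \<open>K\<close>, and no
  block of \<open>P\<close> equals or is adjacent to one of \<open>Q\<close>. Put \<open>x\<close> in every \<open>c n\<close> with \<open>n\<close> in \<open>P\<close>
  by clearing coordinates of a random sequence. Because of the gaps, clearing increases the
  probability of meeting the \<open>d n\<close> of the \<open>Q\<close>-block \<open>k + 1\<close> by a factor of at most \<open>2\<close> to the
  power \<open>(m k)\<^sup>2\<close>, so with positive probability all of them (except in block \<open>0\<close>) are avoided.
  Such an \<open>x\<close> lies in \<open>N_star_set J c\<close> but not in \<open>N_set K d\<close>.
\<close>

section \<open>Ideals\<close>

lemma omega_ideal_subset: "omega_ideal J \<Longrightarrow> A \<in> J \<Longrightarrow> B \<subseteq> A \<Longrightarrow> B \<in> J"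
  unfolding omega_ideal_def by blast

lemma omega_ideal_Un: "omega_ideal J \<Longrightarrow> A \<in> J \<Longrightarrow> B \<in> J \<Longrightarrow> A \<union> B \<in> J"
  unfolding omega_ideal_def by blast

lemma omega_ideal_finite: "omega_ideal J \<Longrightarrow> finite A \<Longrightarrow> A \<in> J"
  unfolding omega_ideal_def by blast

lemma dual_filter_iff: "A \<in> dual_filter J \<longleftrightarrow> - A \<in> J"
  unfolding dual_filter_def by (auto intro: exI[of _ "- A"])

lemma dual_filter_subset_positive_sets:
  assumes "omega_ideal J"
  shows "dual_filter J \<subseteq> positive_sets J"
proof
  fix A assume "A \<in> dual_filter J"
  then have A: "- A \<in> J" by (simp add: dual_filter_iff)
  have "A \<notin> J"
  proof
    assume "A \<in> J"
    then have "A \<union> - A \<in> J" using omega_ideal_Un[OF assms] A by blast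
    then show False using assms by (simp add: omega_ideal_def)
  qed
  then show "A \<in> positive_sets J" by (simp add: positive_sets_def)
qed

lemma N_star_family_subset_N_family:
  assumes "omega_ideal J"
  shows "N_star_family J \<subseteq> N_family J"
  using dual_filter_subset_positive_sets[OF assms]
  unfolding N_star_family_def N_family_def N_star_set_def N_set_def by blast

lemma nearly_coherent_sym: "nearly_coherent J K \<longleftrightarrow> nearly_coherent K J"
  unfolding nearly_coherent_def by (simp add: Un_commute)

text \<open>Unions of a set from one pushforward with a set from the other form a family
  \<open>I\<close> that has every ideal property except possibly properness. Failure of near
  coherence thus forces \<open>UNIV\<close> into \<open>I\<close>, and the resulting cover of
  \<open>UNIV\<close> by \<open>A\<close> and \<open>B\<close> gives the separation.\<close>

lemma not_nearly_coherent_separation: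
  assumes J: "omega_ideal J" and K: "omega_ideal K"
    and nc: "\<not> nearly_coherent J K" and phi: "finite_to_one \<phi>"
  obtains A where "\<phi> -` A \<in> J" "\<phi> -` (- A) \<in> K"
proof -
  define I where "I = {A \<union> B | A B. \<phi> -` A \<in> J \<and> \<phi> -` B \<in> K}"
  have fin: "finite (\<phi> -` A)" if "finite A" for A
  proof -
    have "\<phi> -` A = (\<Union>n\<in>A. \<phi> -` {n})" by auto
    then show ?thesis using that phi by (simp add: finite_to_one_def)
  qed
  have empty: "\<phi> -` {} \<in> J" "\<phi> -` {} \<in> K"
    using fin[of "{}"] omega_ideal_finite J K by blast+
  have sub: "push_family \<phi> J \<union> push_family \<phi> K \<subseteq> I"
  proof
    fix A assume "A \<in> push_family \<phi> J \<union> push_family \<phi> K"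
    moreover have "A = A \<union> {}" "A = {} \<union> A" by auto
    ultimately show "A \<in> I" using empty unfolding I_def push_family_def by blast
  qed
  have "\<not> omega_ideal I" using nc sub phi unfolding nearly_coherent_def by blast
  moreover have "\<forall>C\<in>I. \<forall>D. D \<subseteq> C \<longrightarrow> D \<in> I"
  proof (intro ballI allI impI)
    fix C D assume "C \<in> I" "D \<subseteq> C"
    then obtain A B where AB: "C = A \<union> B" "\<phi> -` A \<in> J" "\<phi> -` B \<in> K"
      unfolding I_def by blast
    have "\<phi> -` (A \<inter> D) \<in> J" "\<phi> -` (B \<inter> D) \<in> K"
      using omega_ideal_subset[OF J AB(2)] omega_ideal_subset[OF K AB(3)] by auto
    moreover have "D = (A \<inter> D) \<union> (B \<inter> D)" using AB \<open>D \<subseteq> C\<close> by blast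
    ultimately show "D \<in> I" unfolding I_def by blast
  qed
  moreover have "\<forall>C\<in>I. \<forall>D\<in>I. C \<union> D \<in> I"
  proof (intro ballI)
    fix C D assume "C \<in> I" "D \<in> I"
    then obtain A B A' B' where AB: "C = A \<union> B" "\<phi> -` A \<in> J" "\<phi> -` B \<in> K"
      "D = A' \<union> B'" "\<phi> -` A' \<in> J" "\<phi> -` B' \<in> K"
      unfolding I_def by blast
    have "\<phi> -` (A \<union> A') \<in> J" "\<phi> -` (B \<union> B') \<in> K"
      using omega_ideal_Un[OF J AB(2,5)] omega_ideal_Un[OF K AB(3,6)]
      by (simp_all add: vimage_Un)
    moreover have "C \<union> D = (A \<union> A') \<union> (B \<union> B')" using AB by blast
    ultimately show "C \<union> D \<in> I" unfolding I_def by blast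
  qed
  moreover have "\<forall>A. finite A \<longrightarrow> A \<in> I"
    using fin omega_ideal_finite[OF J] sub unfolding push_family_def by blast
  ultimately have "UNIV \<in> I" unfolding omega_ideal_def by blast
  then obtain A B where AB: "UNIV = A \<union> B" "\<phi> -` A \<in> J" "\<phi> -` B \<in> K"
    unfolding I_def by blast
  have "\<phi> -` (- A) \<subseteq> \<phi> -` B" using AB(1) by auto
  then show thesis using that[of A] AB omega_ideal_subset[OF K AB(3)] by blast
qed

section \<open>The coin-tossing measure\<close>

definition coin_measure :: "cantor measure" where
  "coin_measure = Pi\<^sub>M UNIV (\<lambda>_. uniform_count_measure (UNIV :: bool set))"

interpretation coin: product_prob_space "\<lambda>_::nat. uniform_count_measure (UNIV :: bool set)" UNIV
  by (simp add: product_prob_spaceI prob_space_uniform_count_measure)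

lemma prob_space_coin_measure: "prob_space coin_measure"
  unfolding coin_measure_def by (rule coin.prob_space_axioms)

interpretation coin_measure: prob_space coin_measure
  by (rule prob_space_coin_measure)

lemma space_coin_measure [simp]: "space coin_measure = UNIV"
  by (simp add: coin_measure_def space_PiM space_uniform_count_measure)

text \<open>Required by \<open>sets_PiM_equal_borel\<close>, which identifies the product
  sigma-algebra with the Borel sets and so makes clopen sets measurable.\<close>

instance bool :: second_countable_topology
proof
  show "\<exists>B::bool set set. countable B \<and> open = generate_topology B"
    by (intro exI[of _ "range lessThan \<union> range greaterThan"])
      (simp add: open_bool_def lessThan_def greaterThan_def)
qed

lemma sets_coin_measure: "sets coin_measure = sets borel"
proof -
  have "sets coin_measure = sets (Pi\<^sub>M UNIV (\<lambda>_::nat. borel :: bool measure))"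
    unfolding coin_measure_def
    by (intro sets_PiM_cong refl) (simp add: sets_borel_eq_count_space sets_uniform_count_measure)
  then show ?thesis by (simp add: sets_PiM_equal_borel)
qed

lemma clopen_sets_measurable: "c \<in> clopen_sets \<Longrightarrow> c \<in> sets coin_measure"
  by (simp add: clopen_sets_def sets_coin_measure borel_open)

lemma measurable_coordinatewise:
  fixes g :: "nat \<Rightarrow> bool \<Rightarrow> bool"
  shows "(\<lambda>x i. g i (x i)) \<in> measurable coin_measure coin_measure"
  unfolding coin_measure_def
proof (rule measurable_PiM_single')
  fix i :: nat
  have "(\<lambda>x. x i) \<in> measurable (Pi\<^sub>M UNIV (\<lambda>_. uniform_count_measure (UNIV :: bool set)))
      (uniform_count_measure UNIV)"
    by (rule measurable_component_singleton) simp
  moreover have "g i \<in> measurable (uniform_count_measure UNIV) (uniform_count_measure UNIV)"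
    by (simp add: measurable_def sets_uniform_count_measure space_uniform_count_measure)
  ultimately show "(\<lambda>x. g i (x i)) \<in> measurable
      (Pi\<^sub>M UNIV (\<lambda>_. uniform_count_measure UNIV)) (uniform_count_measure UNIV)"
    by (rule measurable_compose)
qed (simp add: space_uniform_count_measure)

text \<open>The product measure is determined by its values on cylinders. A flip pulls cylinders
  back to cylinders, permuting \<open>bool\<close> in each coordinate, which keeps the uniform
  measure.\<close>

lemma distr_coin_measure_flip:
  "distr coin_measure coin_measure (\<lambda>x i. x i \<noteq> (i \<in> s)) = coin_measure"
  unfolding coin_measure_def
proof (rule coin.PiM_eq)
  let ?B = "\<lambda>_::nat. uniform_count_measure (UNIV :: bool set)"
  let ?f = "\<lambda>(x::cantor) i. x i \<noteq> (i \<in> s)"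
  fix L :: "nat set" and X :: "nat \<Rightarrow> bool set"
  assume L: "finite L" "L \<subseteq> UNIV" and X: "\<And>j. j \<in> L \<Longrightarrow> X j \<in> sets (?B j)"
  define Y where "Y j = (\<lambda>b. b \<noteq> (j \<in> s)) -` X j" for j
  have "?f -` prod_emb UNIV ?B L (Pi\<^sub>E L X) \<inter> space (Pi\<^sub>M UNIV ?B)
      = prod_emb UNIV ?B L (Pi\<^sub>E L Y)"
    by (auto simp: prod_emb_def Y_def space_PiM space_uniform_count_measure PiE_iff)
  moreover have "?f \<in> measurable (Pi\<^sub>M UNIV ?B) (Pi\<^sub>M UNIV ?B)"
    using measurable_coordinatewise[of "\<lambda>i b. b \<noteq> (i \<in> s)"] by (simp add: coin_measure_def)
  ultimately have "emeasure (distr (Pi\<^sub>M UNIV ?B) (Pi\<^sub>M UNIV ?B) ?f) (prod_emb UNIV ?B L (Pi\<^sub>E L X))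
      = emeasure (Pi\<^sub>M UNIV ?B) (prod_emb UNIV ?B L (Pi\<^sub>E L Y))"
    using L X by (simp add: emeasure_distr sets_PiM_I)
  also have "\<dots> = (\<Prod>j\<in>L. emeasure (?B j) (Y j))"
    using L by (intro coin.emeasure_PiM_emb) (auto simp: sets_uniform_count_measure)
  also have "\<dots> = (\<Prod>j\<in>L. emeasure (?B j) (X j))"
  proof (rule prod.cong[OF refl])
    fix j assume "j \<in> L"
    have "bij (\<lambda>b. b \<noteq> (j \<in> s))" by (cases "j \<in> s") (auto simp: bij_def inj_def surj_def)
    then have "card (Y j) = card (X j)"
      unfolding Y_def by (intro card_vimage_inj) (auto simp: bij_def)
    then show "emeasure (?B j) (Y j) = emeasure (?B j) (X j)"
      by (simp add: emeasure_uniform_count_measure)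
  qed
  finally show "emeasure (distr (Pi\<^sub>M UNIV ?B) (Pi\<^sub>M UNIV ?B) ?f) (prod_emb UNIV ?B L (Pi\<^sub>E L X))
      = (\<Prod>j\<in>L. emeasure (?B j) (X j))" .
qed simp

section \<open>Clearing coordinates of a random sequence\<close>

definition clear_coords :: "nat set \<Rightarrow> cantor \<Rightarrow> cantor" where
  "clear_coords F x = (\<lambda>i. x i \<and> i \<notin> F)"

lemma measurable_clear_coords:
  "clear_coords F \<in> measurable coin_measure coin_measure"
  unfolding clear_coords_def[abs_def]
  using measurable_coordinatewise[of "\<lambda>i b. b \<and> i \<notin> F"] by simp

lemma vimage_clear_coords_measurable:
  "D \<in> sets coin_measure \<Longrightarrow> clear_coords F -` D \<in> sets coin_measure"
  using measurable_sets[OF measurable_clear_coords, of D F] by simp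

text \<open>Clearing the coordinates in \<open>F\<close> agrees, pointwise, with one of the \<open>2 ^ card F\<close>
  measure-preserving flips of a subset of \<open>F\<close>.\<close>

lemma measure_vimage_clear_coords_le:
  assumes D: "D \<in> sets coin_measure" and F: "finite F"
  shows "measure coin_measure (clear_coords F -` D) \<le> 2 ^ card F * measure coin_measure D"
proof -
  define f where "f s = (\<lambda>(x::cantor) i. x i \<noteq> (i \<in> s))" for s
  have f_meas: "f s \<in> measurable coin_measure coin_measure" for s
    unfolding f_def using measurable_coordinatewise[of "\<lambda>i b. b \<noteq> (i \<in> s)"] by simp
  have f_sets: "f s -` D \<in> sets coin_measure" for s
    using measurable_sets[OF f_meas D] by simp
  have f_D: "measure coin_measure (f s -` D) = measure coin_measure D" for s
    using measure_distr[OF f_meas D, of s] distr_coin_measure_flip[of s] by (simp add: f_def)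
  have "clear_coords F -` D \<subseteq> (\<Union>s\<in>Pow F. f s -` D)"
  proof
    fix x assume "x \<in> clear_coords F -` D"
    moreover have "clear_coords F x = f {i\<in>F. x i} x"
      by (auto simp: clear_coords_def f_def)
    ultimately show "x \<in> (\<Union>s\<in>Pow F. f s -` D)" by auto
  qed
  then have "measure coin_measure (clear_coords F -` D)
      \<le> measure coin_measure (\<Union>s\<in>Pow F. f s -` D)"
    using F f_sets by (intro coin_measure.finite_measure_mono) auto
  also have "\<dots> \<le> (\<Sum>s\<in>Pow F. measure coin_measure (f s -` D))"
    using F f_sets by (intro measure_UNION_le) auto
  also have "\<dots> = 2 ^ card F * measure coin_measure D"
    using F by (simp add: f_D card_Pow)
  finally show ?thesis .
qed

section \<open>Clopen sets depend on finitely many coordinates\<close>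

text \<open>One implication says enough: agreement below \<open>b\<close> is symmetric in
  \<open>x\<close> and \<open>y\<close>, so membership is decided by the first \<open>b\<close>
  coordinates.\<close>

definition depends_below :: "cantor set \<Rightarrow> nat \<Rightarrow> bool" where
  "depends_below c b \<longleftrightarrow> (\<forall>x y. (\<forall>i<b. x i = y i) \<longrightarrow> x \<in> c \<longrightarrow> y \<in> c)"

lemma depends_below_mono: "depends_below c b \<Longrightarrow> b \<le> b' \<Longrightarrow> depends_below c b'"
  unfolding depends_below_def
proof (intro allI impI)
  fix x y :: cantor
  assume dep: "\<forall>x y. (\<forall>i<b. x i = y i) \<longrightarrow> x \<in> c \<longrightarrow> y \<in> c"
    and "b \<le> b'" and "\<forall>i<b'. x i = y i" and "x \<in> c"
  then have "\<forall>i<b. x i = y i" by simp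
  with dep[rule_format, of x y] \<open>x \<in> c\<close> show "y \<in> c" by simp
qed

lemma depends_below_UN:
  "(\<And>n. n \<in> N \<Longrightarrow> depends_below (c n) b) \<Longrightarrow> depends_below (\<Union>n\<in>N. c n) b"
  unfolding depends_below_def UN_iff by metis

lemma open_coordinates:
  assumes "open c" "x \<in> c"
  shows "\<exists>b. \<forall>y::cantor. (\<forall>i<b. y i = x i) \<longrightarrow> y \<in> c"
proof -
  have "openin (product_topology (\<lambda>_. euclidean) UNIV) c"
    using assms(1) by (simp add: open_fun_def)
  from product_topology_open_contains_basis[OF this assms(2)]
  obtain X where X: "x \<in> Pi\<^sub>E UNIV X" "finite {i. X i \<noteq> UNIV}" "Pi\<^sub>E UNIV X \<subseteq> c"
    by auto
  obtain b where b: "\<And>i. X i \<noteq> UNIV \<Longrightarrow> i < b"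
    using X(2) finite_nat_set_iff_bounded by auto
  have "y \<in> c" if "\<forall>i<b. y i = x i" for y
  proof -
    have "y i \<in> X i" for i
      using that b[of i] X(1) by (cases "X i = UNIV") (auto simp: PiE_iff)
    then show ?thesis using X(3) by (auto simp: PiE_iff)
  qed
  then show ?thesis by blast
qed

lemma compact_cantor: "compact (UNIV :: cantor set)"
proof -
  have "compact_space (euclidean :: bool topology)"
    by (simp add: compact_space_def compactin_euclidean_iff finite_imp_compact)
  then have "compact_space (product_topology (\<lambda>_::nat. euclidean :: bool topology) UNIV)"
    by (simp add: compact_space_product_topology)
  then show ?thesis
    by (simp add: euclidean_product_topology compact_space_def compactin_euclidean_iff)
qed

text \<open>Each point of \<open>c\<close> has a cylinder inside \<open>c\<close>. By compactness
  finitely many of these cover \<open>c\<close>, and a common bound for their lengths works for all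
  points.\<close>

lemma clopen_depends_below:
  assumes "c \<in> clopen_sets"
  shows "\<exists>b. depends_below c b"
proof -
  have c: "open c" "closed c" using assms by (auto simp: clopen_sets_def)
  have "compact c" using compact_cantor c(2) by (metis compact_Int_closed inf_top_left)
  obtain B where B: "\<And>x y. x \<in> c \<Longrightarrow> \<forall>i<B x. y i = x i \<Longrightarrow> y \<in> c"
    using open_coordinates[OF c(1)] by metis
  define V where "V x = {y::cantor. \<forall>i<B x. y i = x i}" for x
  have "open (V x)" for x
  proof -
    have "open {y::cantor. \<forall>i\<in>{..<B x}. y i \<in> {x i}}"
      by (rule product_topology_basis') (simp_all add: discrete_topology_class.open_discrete)
    then show ?thesis by (simp add: V_def lessThan_def)
  qed
  moreover have "c \<subseteq> (\<Union>x\<in>c. V x)" by (auto simp: V_def)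
  ultimately obtain T where T: "T \<subseteq> c" "finite T" "c \<subseteq> (\<Union>x\<in>T. V x)"
    using compactE_image[OF \<open>compact c\<close>, of c V] by metis
  obtain b where b: "\<And>x. x \<in> T \<Longrightarrow> B x \<le> b"
    using T(2) finite_nat_set_iff_bounded_le[of "B ` T"] by auto
  have "y \<in> c" if "\<forall>i<b. x i = y i" "x \<in> c" for x y
  proof -
    obtain z where z: "z \<in> T" "x \<in> V z" using T(3) \<open>x \<in> c\<close> by blast
    have "y i = z i" if "i < B z" for i
      using that z(2) b[OF z(1)] \<open>\<forall>i<b. x i = y i\<close> by (simp add: V_def)
    then show ?thesis using B[of z y] z(1) T(1) by blast
  qed
  then show ?thesis unfolding depends_below_def by blast
qed

text \<open>Clear \<open>F\<close> in a random sequence and apply the union bound to the events of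
  landing in \<open>D k\<close>. Since \<open>D k\<close> sees only coordinates below
  \<open>b k\<close>, clearing costs a factor exponential only in the number of elements of
  \<open>F\<close> below \<open>b k\<close>.\<close>

lemma exists_zero_on_avoiding:
  fixes b :: "nat \<Rightarrow> nat"
  assumes D: "\<And>k. D k \<in> sets coin_measure" and dep: "\<And>k. depends_below (D k) (b k)"
    and small: "\<And>k. 2 ^ card (F \<inter> {..<b k}) * measure coin_measure (D k) \<le> (1/2) ^ (k + 2)"
  shows "\<exists>x. (\<forall>i\<in>F. \<not> x i) \<and> (\<forall>k. x \<notin> D k)"
proof -
  define E where "E k = clear_coords F -` D k" for k
  have E_sets: "E k \<in> sets coin_measure" for k
    unfolding E_def by (rule vimage_clear_coords_measurable[OF D])
  have E_small: "measure coin_measure (E k) \<le> (1/2) ^ (k + 2)" for k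
  proof -
    have agree: "\<forall>i<b k. clear_coords F x i = clear_coords (F \<inter> {..<b k}) x i" for x
      by (auto simp: clear_coords_def)
    have "E k = clear_coords (F \<inter> {..<b k}) -` D k"
      using dep[of k] agree unfolding E_def depends_below_def vimage_def by (metis (no_types, lifting))
    then show ?thesis
      using measure_vimage_clear_coords_le[OF D, of "F \<inter> {..<b k}" k] small[of k] by simp
  qed
  \<comment> \<open>The total 1/2 is below the full measure 1, so some sequence escapes every
    \<open>E k\<close>.\<close>
  have sums: "(\<lambda>k. (1/2::real) ^ (k + 2)) sums (1/2)"
    using sums_mult[OF geometric_sums[of "1/2::real"], of "1/4"]
    by (simp add: power_add power2_eq_square field_simps)
  have summable: "summable (\<lambda>k. measure coin_measure (E k))"
    by (rule summable_comparison_test'[OF sums_summable[OF sums], of 0]) (use E_small in simp)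
  have "measure coin_measure (\<Union>k. E k) \<le> (\<Sum>k. measure coin_measure (E k))"
    using E_sets summable by (intro coin_measure.finite_measure_subadditive_countably) auto
  also have "\<dots> \<le> (\<Sum>k. (1/2) ^ (k + 2))"
    by (rule suminf_le[OF E_small summable sums_summable[OF sums]])
  also have "\<dots> = 1/2" using sums sums_unique by metis
  finally have "(\<Union>k. E k) \<noteq> UNIV"
    using coin_measure.prob_space by auto
  then obtain y where "\<And>k. y \<notin> E k" by blast
  then show ?thesis
    by (intro exI[of _ "clear_coords F y"]) (auto simp: E_def clear_coords_def)
qed

section \<open>Zero blocks\<close>

text \<open>Consecutive squares cut out disjoint intervals of length 2n+1: long enough for summable
  measures, while the indices below \<open>a\<close> use exactly the coordinates below
  \<open>a\<^sup>2\<close>.\<close>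

definition zero_block :: "nat \<Rightarrow> cantor set" where
  "zero_block n = {x. \<forall>i\<in>{n\<^sup>2..<(Suc n)\<^sup>2}. \<not> x i}"

lemma zero_block_clopen: "zero_block n \<in> clopen_sets"
proof -
  have "open {x::cantor. \<forall>i\<in>{n\<^sup>2..<(Suc n)\<^sup>2}. x i \<in> {False}}"
    by (rule product_topology_basis') (simp_all add: discrete_topology_class.open_discrete)
  moreover have "- zero_block n = (\<Union>i\<in>{n\<^sup>2..<(Suc n)\<^sup>2}. {x. \<forall>j\<in>{i}. x j \<in> {True}})"
    by (auto simp: zero_block_def)
  moreover have "open {x::cantor. \<forall>j\<in>{i}. x j \<in> {True}}" for i
    by (rule product_topology_basis') (simp_all add: discrete_topology_class.open_discrete)
  ultimately show ?thesis
    unfolding clopen_sets_def closed_def by (auto simp: zero_block_def)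
qed

lemma measure_zero_block_le: "measure coin_measure (zero_block n) \<le> (1/2) ^ n"
proof -
  let ?B = "\<lambda>_::nat. uniform_count_measure (UNIV :: bool set)"
  let ?L = "{n\<^sup>2..<(Suc n)\<^sup>2}"
  have "zero_block n = prod_emb UNIV ?B ?L (Pi\<^sub>E ?L (\<lambda>_. {False}))"
    by (auto simp: zero_block_def prod_emb_def space_uniform_count_measure restrict_def fun_eq_iff)
  then have "measure coin_measure (zero_block n) = (\<Prod>i\<in>?L. measure (?B i) {False})"
    unfolding coin_measure_def
    by (simp only:) (rule coin.measure_PiM_emb; simp add: sets_uniform_count_measure)
  also have "\<dots> = (1/2) ^ (2 * n + 1)"
    by (simp add: measure_uniform_count_measure power2_eq_square mult_2)
  also have "\<dots> \<le> (1/2) ^ n" by (rule power_decreasing) auto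
  finally show ?thesis .
qed

section \<open>Null limsup sets\<close>

lemma N_limsup_eq: "N_limsup c = (\<Inter>m. \<Union>n\<in>{m..}. c n)"
  unfolding N_limsup_def by (auto simp: INFM_nat_le)

lemma N_limsup_measurable:
  assumes "\<And>n. c n \<in> clopen_sets"
  shows "N_limsup c \<in> sets coin_measure"
  unfolding N_limsup_eq using clopen_sets_measurable[OF assms] by (intro sets.countable_INT) auto

text \<open>The limsup of clopen sets is already Borel, so nullity in the completion reduces to
  nullity for \<open>coin_measure\<close>.\<close>

lemma Omega_bar_iff:
  "c \<in> Omega_bar \<longleftrightarrow> (\<forall>n. c n \<in> clopen_sets) \<and> N_limsup c \<in> null_sets coin_measure"
  using N_limsup_measurable[of c] null_sets_completion_iff[of "N_limsup c" coin_measure]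
  unfolding Omega_bar_def cantor_measure_def coin_measure_def[symmetric] by auto

lemma zero_block_Omega_bar: "zero_block \<in> Omega_bar"
proof -
  have "limsup zero_block \<in> null_sets coin_measure"
  proof (rule borel_cantelli_limsup1)
    show "summable (\<lambda>n. measure coin_measure (zero_block n))"
      by (rule summable_comparison_test'[where g = "\<lambda>n. (1/2::real) ^ n" and N = 0])
        (use measure_zero_block_le in simp_all)
  qed (simp_all add: clopen_sets_measurable zero_block_clopen
      coin_measure.emeasure_eq_measure)
  moreover have "limsup zero_block = N_limsup zero_block"
    by (simp add: limsup_INF_SUP N_limsup_eq)
  ultimately show ?thesis by (simp add: Omega_bar_iff zero_block_clopen)
qed

text \<open>The tail unions decrease to the null set \<open>N_limsup d\<close>; continuity from
  above gives the limit.\<close>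

lemma Omega_bar_tail_measure:
  assumes "d \<in> Omega_bar"
  shows "(\<lambda>m. measure coin_measure (\<Union>n\<in>{m..}. d n)) \<longlonglongrightarrow> 0"
proof -
  have d: "\<And>n. d n \<in> sets coin_measure" "N_limsup d \<in> null_sets coin_measure"
    using assms clopen_sets_measurable by (auto simp: Omega_bar_iff)
  have "(\<lambda>m. measure coin_measure (\<Union>n\<in>{m..}. d n))
      \<longlonglongrightarrow> measure coin_measure (\<Inter>m. \<Union>n\<in>{m..}. d n)"
    using d(1) by (intro coin_measure.finite_Lim_measure_decseq)
      (auto simp: decseq_def intro: order_trans)
  then show ?thesis using d(2) by (simp add: N_limsup_eq measure_eq_0_null_sets)
qed

section \<open>Separation by interval partitions\<close>

text \<open>For strictly increasing \<open>m\<close> with \<open>m 0 = 0\<close> this is the unique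
  \<open>k\<close> with \<open>m k \<le> n < m (Suc k)\<close>.\<close>

definition block_index :: "(nat \<Rightarrow> nat) \<Rightarrow> nat \<Rightarrow> nat" where
  "block_index m n = (LEAST k. n < m (Suc k))"

context
  fixes m :: "nat \<Rightarrow> nat"
  assumes m: "strict_mono m" and m0: "m 0 = 0"
begin

lemma block_index_upper: "n < m (Suc (block_index m n))"
  unfolding block_index_def
  by (rule LeastI[of _ n]) (use strict_mono_imp_increasing[OF m, of "Suc n"] in simp)

lemma block_index_lower: "m (block_index m n) \<le> n"
proof (cases "block_index m n")
  case 0
  then show ?thesis by (simp add: m0)
next
  case (Suc k)
  then have "\<not> n < m (Suc k)"
    using not_less_Least[of k "\<lambda>k. n < m (Suc k)"] by (simp add: block_index_def)
  then show ?thesis using Suc by simp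
qed

lemma block_index_less: "n < m k \<Longrightarrow> block_index m n < k"
  using block_index_lower[of n] strict_mono_less[OF m] by (meson order_le_less_trans)

text \<open>The bound on \<open>g\<close> makes its fibres finite, and blocks are finite. It holds
  for both pairings, \<open>k div 2\<close> and \<open>Suc k div 2\<close>.\<close>

lemma finite_to_one_block_index:
  assumes "\<And>k. k \<le> 2 * g k + 1"
  shows "finite_to_one (\<lambda>n. g (block_index m n))"
  unfolding finite_to_one_def
proof
  fix j
  have "(\<lambda>n. g (block_index m n)) -` {j} \<subseteq> {..<m (Suc (2 * j + 1))}"
  proof
    fix n assume "n \<in> (\<lambda>n. g (block_index m n)) -` {j}"
    then have "block_index m n \<le> 2 * j + 1" using assms[of "block_index m n"] by simp
    then have "m (Suc (block_index m n)) \<le> m (Suc (2 * j + 1))"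
      using strict_mono_less_eq[OF m] by simp
    then show "n \<in> {..<m (Suc (2 * j + 1))}" using block_index_upper[of n] by simp
  qed
  then show "finite ((\<lambda>n. g (block_index m n)) -` {j})" by (rule finite_subset) simp
qed

text \<open>Merging the blocks in pairs \<open>{2k, 2k+1}\<close> and also in pairs \<open>{2k-1, 2k}\<close> puts any two
  neighbouring blocks into a common pair. Hence a block of \<open>P\<close> and a block of \<open>Q\<close> are never
  neighbours.\<close>

lemma not_nearly_coherent_gap:
  assumes J: "omega_ideal J" and K: "omega_ideal K" and nc: "\<not> nearly_coherent J K"
  obtains P Q where "{n. block_index m n \<notin> P} \<in> J" "{n. block_index m n \<notin> Q} \<in> K"
    "P \<inter> Q = {}" "\<And>k. k \<in> P \<Longrightarrow> Suc k \<notin> Q" "\<And>k. k \<in> Q \<Longrightarrow> Suc k \<notin> P"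
proof -
  let ?e = "\<lambda>n. block_index m n div 2" and ?o = "\<lambda>n. Suc (block_index m n) div 2"
  have "finite_to_one ?e" by (rule finite_to_one_block_index) presburger
  then obtain A where A: "?e -` A \<in> J" "?e -` (- A) \<in> K"
    using not_nearly_coherent_separation[OF J K nc] by metis
  have "finite_to_one ?o" by (rule finite_to_one_block_index) presburger
  then obtain B where B: "?o -` B \<in> J" "?o -` (- B) \<in> K"
    using not_nearly_coherent_separation[OF J K nc] by metis
  \<comment> \<open>Blocks on which the two colourings disagree go to neither set and form the
    gaps.\<close>
  define P where "P = {k. k div 2 \<notin> A \<and> Suc k div 2 \<notin> B}"
  define Q where "Q = {k. k div 2 \<in> A \<and> Suc k div 2 \<in> B}"
  have pair: "Suc k div 2 = k div 2 \<or> Suc (Suc k) div 2 = Suc k div 2" for k by presburger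
  show thesis
  proof
    have "{n. block_index m n \<notin> P} = ?e -` A \<union> ?o -` B" by (auto simp: P_def)
    then show "{n. block_index m n \<notin> P} \<in> J" using omega_ideal_Un[OF J A(1) B(1)] by simp
    have "{n. block_index m n \<notin> Q} = ?e -` (- A) \<union> ?o -` (- B)" by (auto simp: Q_def)
    then show "{n. block_index m n \<notin> Q} \<in> K" using omega_ideal_Un[OF K A(2) B(2)] by simp
    show "P \<inter> Q = {}" by (auto simp: P_def Q_def)
    show "Suc k \<notin> Q" if "k \<in> P" for k using that pair[of k] by (auto simp: P_def Q_def)
    show "Suc k \<notin> P" if "k \<in> Q" for k using that pair[of k] by (auto simp: P_def Q_def)
  qed
qed

end

text \<open>The sequence is built recursively. The exponent \<open>(m k)\<^sup>2\<close> is the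
  number of coordinates read by all \<open>zero_block n\<close> with \<open>n < m k\<close>, hence
  bounds what clearing them can cost.\<close>

lemma sparse_sequence:
  assumes "d \<in> Omega_bar"
  obtains m :: "nat \<Rightarrow> nat" where "strict_mono m" "m 0 = 0"
    "\<And>k n. n < m k \<Longrightarrow> depends_below (d n) ((m (Suc k))\<^sup>2)"
    "\<And>k. 2 ^ ((m k)\<^sup>2) * measure coin_measure (\<Union>n\<in>{m (Suc k)..}. d n) \<le> (1/2) ^ (k + 2)"
proof -
  define R where "R k a b \<longleftrightarrow> a < b \<and> (\<forall>n<a. depends_below (d n) (b\<^sup>2)) \<and>
    2 ^ (a\<^sup>2) * measure coin_measure (\<Union>n\<in>{b..}. d n) \<le> (1/2) ^ (k + 2)" for k a b :: nat
  have "\<exists>b. depends_below (d n) b" for n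
    using assms clopen_depends_below by (auto simp: Omega_bar_iff)
  then obtain B where B: "\<And>n. depends_below (d n) (B n)" by metis
  have ex: "\<exists>b. R k a b" for k a
  proof -
    let ?e = "(1/2) ^ (k + 2) / 2 ^ (a\<^sup>2) :: real"
    have "eventually (\<lambda>b. measure coin_measure (\<Union>n\<in>{b..}. d n) < ?e) sequentially"
      by (rule order_tendstoD(2)[OF Omega_bar_tail_measure[OF assms]]) simp
    then obtain N where N: "\<And>b. b \<ge> N \<Longrightarrow> measure coin_measure (\<Union>n\<in>{b..}. d n) < ?e"
      unfolding eventually_sequentially by blast
    \<comment> \<open>\<open>N\<close> secures the small tail, \<open>Suc a\<close> the strict
      growth, and the sum dominates every \<open>B n\<close> with \<open>n < a\<close>.\<close>
    define b where "b = N + Suc a + (\<Sum>n<a. B n)"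
    have "depends_below (d n) (b\<^sup>2)" if "n < a" for n
    proof -
      have "B n \<le> (\<Sum>n<a. B n)" using that by (intro member_le_sum) auto
      also have "\<dots> \<le> b" by (simp add: b_def)
      also have "b \<le> b\<^sup>2" by (simp add: power2_nat_le_imp_le power2_eq_square)
      finally show ?thesis using B depends_below_mono by blast
    qed
    moreover have "2 ^ (a\<^sup>2) * measure coin_measure (\<Union>n\<in>{b..}. d n) \<le> (1/2) ^ (k + 2)"
      using N[of b] by (simp add: b_def field_simps)
    ultimately have "R k a b" by (simp add: R_def b_def)
    then show ?thesis by blast
  qed
  define m where "m = rec_nat 0 (\<lambda>k a. SOME b. R k a b)"
  have step: "R k (m k) (m (Suc k))" for k
    using someI_ex[OF ex[of k "m k"]] by (simp add: m_def)
  show thesis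
  proof
    show "strict_mono m" using step by (simp add: strict_mono_Suc_iff R_def)
    show "m 0 = 0" by (simp add: m_def)
  qed (use step in \<open>auto simp: R_def\<close>)
qed

section \<open>Combining the separated blocks with the measure estimate\<close>

lemma zero_block_not_in_N_family:
  assumes J: "omega_ideal J" and K: "omega_ideal K" and nc: "\<not> nearly_coherent J K"
  shows "N_star_set J zero_block \<notin> N_family K"
proof
  assume "N_star_set J zero_block \<in> N_family K"
  then obtain d where d: "d \<in> Omega_bar" and sub: "N_star_set J zero_block \<subseteq> N_set K d"
    by (auto simp: N_family_def)
  obtain m where m: "strict_mono m" "m 0 = 0"
    and dep: "\<And>k n. n < m k \<Longrightarrow> depends_below (d n) ((m (Suc k))\<^sup>2)"
    and small: "\<And>k. 2 ^ ((m k)\<^sup>2) * measure coin_measure (\<Union>n\<in>{m (Suc k)..}. d n) \<le> (1/2) ^ (k + 2)"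
    using sparse_sequence[OF d] by metis
  obtain P Q where P: "{n. block_index m n \<notin> P} \<in> J" and Q: "{n. block_index m n \<notin> Q} \<in> K"
    and PQ: "P \<inter> Q = {}" "\<And>k. k \<in> P \<Longrightarrow> Suc k \<notin> Q" "\<And>k. k \<in> Q \<Longrightarrow> Suc k \<notin> P"
    using not_nearly_coherent_gap[OF m J K nc] by metis
  have d_sets: "d n \<in> sets coin_measure" for n
    using d clopen_sets_measurable by (auto simp: Omega_bar_iff)
  define F where "F = (\<Union>n\<in>{n. block_index m n \<in> P}. {n\<^sup>2..<(Suc n)\<^sup>2})"
  \<comment> \<open>The shift by one lets the tail estimate at \<open>m (Suc k)\<close> control
    block \<open>Suc k\<close>. Block 0 is left out and treated as a finite set at the end.\<close>
  define D where "D k = (if Suc k \<in> Q then \<Union>n\<in>{m (Suc k)..<m (Suc (Suc k))}. d n else {})" for k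
  have "\<exists>x. (\<forall>i\<in>F. \<not> x i) \<and> (\<forall>k. x \<notin> D k)"
  \<comment> \<open>The indices in \<open>D k\<close> lie below \<open>m (k + 2)\<close>, so
    \<open>dep\<close> bounds their coordinates by the square of \<open>m (k + 3)\<close>.\<close>
  proof (rule exists_zero_on_avoiding[where b = "\<lambda>k. (m (k + 3))\<^sup>2"])
    fix k
    show "D k \<in> sets coin_measure" using d_sets by (auto simp: D_def)
    show "depends_below (D k) ((m (k + 3))\<^sup>2)"
    proof (cases "Suc k \<in> Q")
      case True
      have "k + 3 = Suc (Suc (Suc k))" by simp
      then have "depends_below (\<Union>n\<in>{m (Suc k)..<m (Suc (Suc k))}. d n) ((m (k + 3))\<^sup>2)"
        using dep[of _ "Suc (Suc k)"] by (intro depends_below_UN) (metis atLeastLessThan_iff)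
      then show ?thesis using True by (simp add: D_def)
    qed (simp add: D_def depends_below_def)
    show "2 ^ card (F \<inter> {..<(m (k + 3))\<^sup>2}) * measure coin_measure (D k) \<le> (1/2) ^ (k + 2)"
    proof (cases "Suc k \<in> Q")
      case True
      \<comment> \<open>The gap pays off here: \<open>Suc k \<in> Q\<close> keeps blocks
        \<open>k\<close>, \<open>k + 1\<close> and \<open>k + 2\<close> out of \<open>P\<close>, so
        the relevant part of \<open>F\<close> comes from blocks before \<open>k\<close>.\<close>
      have "F \<inter> {..<(m (k + 3))\<^sup>2} \<subseteq> {..<(m k)\<^sup>2}"
      proof
        fix i assume i: "i \<in> F \<inter> {..<(m (k + 3))\<^sup>2}"
        then obtain n where n: "block_index m n \<in> P" "n\<^sup>2 \<le> i" "i < (Suc n)\<^sup>2"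
          by (auto simp: F_def)
        have "n\<^sup>2 < (m (k + 3))\<^sup>2" using n(2) i by simp
        then have "n < m (k + 3)" by (rule power_less_imp_less_base) simp
        then have "block_index m n < k + 3" by (rule block_index_less[OF m])
        moreover have "block_index m n \<noteq> k" using PQ(2)[OF n(1)] True by metis
        moreover have "block_index m n \<noteq> Suc k" using PQ(1) n(1) True by (metis disjoint_iff)
        moreover have "block_index m n \<noteq> Suc (Suc k)" using PQ(3)[OF True] n(1) by metis
        ultimately have "Suc (block_index m n) \<le> k" by linarith
        then have "m (Suc (block_index m n)) \<le> m k" using strict_mono_less_eq[OF m(1)] by simp
        then have "Suc n \<le> m k" using block_index_upper[OF m, of n] by simp
        then have "(Suc n)\<^sup>2 \<le> (m k)\<^sup>2" by (rule power_mono) simp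
        then show "i \<in> {..<(m k)\<^sup>2}" using n(3) by (metis lessThan_iff order_less_le_trans)
      qed
      then have "card (F \<inter> {..<(m (k + 3))\<^sup>2}) \<le> (m k)\<^sup>2"
        using card_mono[OF finite_lessThan] by fastforce
      then have "(2::real) ^ card (F \<inter> {..<(m (k + 3))\<^sup>2}) \<le> 2 ^ ((m k)\<^sup>2)"
        by (intro power_increasing) auto
      moreover have "measure coin_measure (D k) \<le> measure coin_measure (\<Union>n\<in>{m (Suc k)..}. d n)"
        using d_sets by (intro coin_measure.finite_measure_mono) (auto simp: D_def)
      ultimately have "2 ^ card (F \<inter> {..<(m (k + 3))\<^sup>2}) * measure coin_measure (D k)
          \<le> 2 ^ ((m k)\<^sup>2) * measure coin_measure (\<Union>n\<in>{m (Suc k)..}. d n)"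
        by (intro mult_mono) auto
      then show ?thesis using small[of k] by linarith
    qed (simp add: D_def)
  qed
  then obtain x where xF: "\<And>i. i \<in> F \<Longrightarrow> \<not> x i" and xD: "\<And>k. x \<notin> D k" by blast
  have "- {n. x \<in> zero_block n} \<subseteq> {n. block_index m n \<notin> P}"
    using xF unfolding F_def zero_block_def by blast
  then have "x \<in> N_star_set J zero_block"
    using omega_ideal_subset[OF J P] by (simp add: N_star_set_def dual_filter_iff)
  moreover have "{n. x \<in> d n} \<subseteq> {n. block_index m n \<notin> Q} \<union> {..<m 1}"
  proof
    fix n assume n: "n \<in> {n. x \<in> d n}"
    show "n \<in> {n. block_index m n \<notin> Q} \<union> {..<m 1}"
    proof (cases "block_index m n")
      case 0
      then show ?thesis using block_index_upper[OF m, of n] by simp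
    next
      case (Suc k)
      then have "n \<in> {m (Suc k)..<m (Suc (Suc k))}"
        using block_index_upper[OF m, of n] block_index_lower[OF m, of n] by simp
      then have "Suc k \<notin> Q" using xD[of k] n by (auto simp: D_def)
      then show ?thesis using Suc by simp
    qed
  qed
  then have "{n. x \<in> d n} \<in> K"
    using omega_ideal_subset[OF K omega_ideal_Un[OF K Q omega_ideal_finite[OF K]]] by blast
  then have "x \<notin> N_set K d" by (simp add: N_set_def positive_sets_def)
  ultimately show False using sub by blast
qed

lemma N_star_family_not_subset_N_family:
  assumes "omega_ideal J" "omega_ideal K" "\<not> nearly_coherent J K"
  shows "\<not> N_star_family J \<subseteq> N_family K"
  using zero_block_not_in_N_family[OF assms] zero_block_Omega_bar
  unfolding N_star_family_def by blast

theorem theorem4p8: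
  fixes J K :: "nat set set"
  assumes "omega_ideal J" and "omega_ideal K"
    and "\<not> nearly_coherent J K"
  shows "\<not> N_star_family J \<subseteq> N_family K \<and>
         \<not> N_star_family K \<subseteq> N_family J \<and>
         N_family K \<noteq> N_family J \<and>
         N_star_family J \<noteq> N_star_family K"
proof -
  have JK: "\<not> N_star_family J \<subseteq> N_family K"
    by (rule N_star_family_not_subset_N_family[OF assms])
  have KJ: "\<not> N_star_family K \<subseteq> N_family J"
    using N_star_family_not_subset_N_family[OF assms(2,1)] assms(3) nearly_coherent_sym by blast
  \<comment> \<open>Each starred family lies in the unstarred one, so either equality would put
    \<open>N_star_family J\<close> inside \<open>N_family K\<close>.\<close>
  show ?thesis
    using JK KJ N_star_family_subset_N_family[OF assms(1)] N_star_family_subset_N_family[OF assms(2)]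
    by auto
qed

end
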